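(* Let $G$ be a connected cograph of size $n$. Let $\tilde\lambda_1,\ldots,\tilde\lambda_r$ be the distinct eigenvalues of $L(G)$, with multiplicities $q_1,\ldots,q_r$, and let $V(G)=[V^{(1)},\ldots,V^{(r)}]\in\mathbb{R}^{n\times n}$ be a normalized modal matrix, where $V^{(i)}=[V^{(i)}_1,\ldots,V^{(i)}_{q_i}]\in\mathbb{R}^{n\times q_i}$ satisfies $L(G)V^{(i)}=\tilde\lambda_iV^{(i)}$. Let $q_k=\max\{q_1,\ldots,q_r\}$, and for each $1\le i\le r$ let $\bar V^{(i)}=[V^{(i)}_1,\ldots,V^{(i)}_{q_i},\mathbf{0}_{n\times(q_k-q_i)}]\in\mathbb{R}^{n\times q_k}$. Then the network $\dot x=-L(G)x+Bu$ is controllable with $$B=\Big[\sum_{i=1}^r\bar V^{(i)}_{:,1},\ \ldots,\ \sum_{i=1}^r\bar V^{(i)}_{:,q_k}\Big]\in\mathbb{R}^{n\times q_k}.$$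
   Context: All graphs are finite, undirected, unweighted and loop-free. $L(G)=\Delta(G)-A(G)$ is the Laplacian matrix, with $\Delta(G)$ the diagonal matrix of node degrees and $A(G)$ the $(0,1)$-adjacency matrix. The union of two disjoint graphs $G_1=(V_1,E_1)$, $G_2=(V_2,E_2)$ is $G_1+G_2=(V_1\cup V_2,E_1\cup E_2)$; their join $G_1*G_2$ is obtained from $G_1+G_2$ by adding an edge between every node of $G_1$ and every node of $G_2$. A cograph is a graph that can be constructed from isolated nodes by successively performing join and union operations. A modal matrix is a nonsingular matrix whose columns are eigenvectors of $L(G)$; it is normalized if $V(G)V(G)^T=V(G)^TV(G)=I_n$ (orthonormal columns). $M_{:,j}$ denotes the $j$-th column of a matrix $M$, and $\mathbf{0}_{n\times p}$ is the $n\times p$ zero matrix. The network $\dot x=Ax+Bu$ with $A=-L(G)$ is controllable in the usual sense of linear time-invariant systems (i.e. $\mathrm{rank}[B,AB,\ldots,A^{n-1}B]=n$). *)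

theory Defs
  imports
    "Graph_Theory.Digraph_Component"
    "Graph_Theory.Pair_Digraph"
    "Jordan_Normal_Form.Char_Poly"
    "Jordan_Normal_Form.DL_Rank"
begin

text \<open>
  A finite simple undirected graph is a \<open>pair_graph\<close>: an edge between \<open>u\<close> and \<open>v\<close> is
  represented by the two arcs \<open>(u, v)\<close> and \<open>(v, u)\<close>.
\<close>

definition graph_union :: "'a pair_pre_digraph \<Rightarrow> 'a pair_pre_digraph \<Rightarrow> 'a pair_pre_digraph" where
  "graph_union G H = \<lparr> pverts = pverts G \<union> pverts H, parcs = parcs G \<union> parcs H \<rparr>"

definition graph_join :: "'a pair_pre_digraph \<Rightarrow> 'a pair_pre_digraph \<Rightarrow> 'a pair_pre_digraph" where
  "graph_join G H =
     \<lparr> pverts = pverts (graph_union G H),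
       parcs = parcs (graph_union G H) \<union> pverts G \<times> pverts H \<union> pverts H \<times> pverts G \<rparr>"

inductive cograph :: "'a pair_pre_digraph \<Rightarrow> bool" where
  isolated_node: "cograph \<lparr> pverts = {v}, parcs = {} \<rparr>"
| union: "cograph G \<Longrightarrow> cograph H \<Longrightarrow> pverts G \<inter> pverts H = {} \<Longrightarrow> cograph (graph_union G H)"
| join: "cograph G \<Longrightarrow> cograph H \<Longrightarrow> pverts G \<inter> pverts H = {} \<Longrightarrow> cograph (graph_join G H)"

lemma pair_graph_iff:
  "pair_graph G \<longleftrightarrow> finite (pverts G) \<and> parcs G \<subseteq> pverts G \<times> pverts G \<and>
     sym (parcs G) \<and> irrefl (parcs G)"
proof
  assume "pair_graph G"
  then interpret pair_graph G .
  show "finite (pverts G) \<and> parcs G \<subseteq> pverts G \<times> pverts G \<and> sym (parcs G) \<and> irrefl (parcs G)"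
    using pair_finite_verts no_loops'
    by (auto intro!: symI irreflI dest: arcs_symmetric in_arcsD1 in_arcsD2)
next
  assume *: "finite (pverts G) \<and> parcs G \<subseteq> pverts G \<times> pverts G \<and>
     sym (parcs G) \<and> irrefl (parcs G)"
  then have "finite (parcs G)"
    by (meson finite_SigmaI finite_subset)
  with * show "pair_graph G"
    by unfold_locales (auto simp: symmetric_def irrefl_def)
qed

lemma cograph_imp_pair_graph: "cograph G \<Longrightarrow> pair_graph G"
proof (induction rule: cograph.induct)
  case (isolated_node v)
  then show ?case by (auto simp: pair_graph_iff sym_def irrefl_def)
next
  case (union G H)
  then show ?case
    by (auto simp: pair_graph_iff graph_union_def irrefl_def intro: sym_Un)
next
  case (join G H)
  then show ?case
    by (auto simp: pair_graph_iff graph_join_def graph_union_def irrefl_def sym_def)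
qed

text \<open>
  The list \<open>vs\<close> enumerates the nodes; it fixes which node belongs to which row and column.
  The arcs leaving a node correspond exactly to its incident edges, so \<open>out_degree\<close> is the
  undirected degree.
\<close>

definition degree_matrix :: "'a list \<Rightarrow> 'a pair_pre_digraph \<Rightarrow> real mat" where
  "degree_matrix vs G =
     mat_diag (length vs) (\<lambda>i. real (out_degree (with_proj G) (vs ! i)))"

definition adjacency_matrix :: "'a list \<Rightarrow> 'a pair_pre_digraph \<Rightarrow> real mat" where
  "adjacency_matrix vs G =
     mat (length vs) (length vs) (\<lambda>(i, j). if (vs ! i, vs ! j) \<in> parcs G then 1 else 0)"

definition laplacian :: "'a list \<Rightarrow> 'a pair_pre_digraph \<Rightarrow> real mat" where
  "laplacian vs G = degree_matrix vs G - adjacency_matrix vs G"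

definition hconcat :: "nat \<Rightarrow> 'a mat list \<Rightarrow> 'a mat" \<comment> \<open>\<open>[M\<^sub>1, \<dots>, M\<^sub>r]\<close>, each block with \<open>n\<close> rows\<close>
  where "hconcat n Ms = mat_of_cols n (concat (map cols Ms))"

definition modal_matrix :: "real mat \<Rightarrow> real mat \<Rightarrow> bool" where
  "modal_matrix M V \<longleftrightarrow>
     V \<in> carrier_mat (dim_row M) (dim_row M) \<and> invertible_mat V \<and>
     (\<forall>j < dim_col V. \<exists>x. eigenvector M (col V j) x)"

definition normalized_modal_matrix :: "real mat \<Rightarrow> real mat \<Rightarrow> bool" where
  "normalized_modal_matrix M V \<longleftrightarrow>
     modal_matrix M V \<and>
     V * transpose_mat V = 1\<^sub>m (dim_row M) \<and> transpose_mat V * V = 1\<^sub>m (dim_row M)"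

definition controllability_matrix :: "real mat \<Rightarrow> real mat \<Rightarrow> real mat" where
  "controllability_matrix A B = hconcat (dim_row A) (map (\<lambda>k. A ^\<^sub>m k * B) [0..<dim_row A])"

text \<open>Controllability of \<open>dx/dt = A x + B u\<close>.\<close>

definition controllable :: "real mat \<Rightarrow> real mat \<Rightarrow> bool" where
  "controllable A B \<longleftrightarrow>
     square_mat A \<and> dim_row B = dim_row A \<and>
     vec_space.rank (dim_row A) (controllability_matrix A B) = dim_row A"

end

theory Submission
  imports Defs
begin

text \<open>
  The powers of \<open>A = - L\<close> separate the eigenvectors that each column of \<open>B\<close> superposes. Let \<open>w\<close> be orthogonal to
  every vector \<open>A\<^sup>m b\<close> with \<open>m < n\<close> and \<open>b\<close> a column of \<open>B\<close>. The \<open>j\<close>-th column of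
  \<open>B\<close> is a sum of vectors \<open>u\<^sub>i\<close>, one for each distinct eigenvalue \<open>\<mu>\<^sub>i\<close> of \<open>A\<close>: the \<open>j\<close>-th
  chosen eigenvector for \<open>\<mu>\<^sub>i\<close>, or zero if that eigenspace has fewer than \<open>j\<close> of them. Hence
  \<open>\<Sum>\<^sub>i \<mu>\<^sub>i\<^sup>m (w \<bullet> u\<^sub>i) = 0\<close> for all \<open>m < n\<close>. There are at most \<open>n\<close> distinct eigenvalues, so this
  Vandermonde system forces each \<open>w \<bullet> u\<^sub>i\<close> to vanish (\<open>power_sums_eq_0_imp_eq_0\<close>). As \<open>j\<close> varies,
  \<open>w\<close> is seen to be orthogonal to every column of the orthogonal matrix \<open>V\<close>, so \<open>w = 0\<close>.

  A vector orthogonal to the whole reachable space is therefore zero, and for real matrices this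
  means that the controllability matrix has full rank (\<open>rank_eq_if_trivial_left_kernel\<close>).
\<close>

section \<open>Vandermonde systems and powers of a matrix\<close>

text \<open>
  Injectivity of the transposed Vandermonde matrix: the hypothesis extends by linearity from powers
  to polynomials of degree below \<open>card I\<close>, and the Lagrange polynomial vanishing at all nodes except
  \<open>\<mu> l\<close> isolates \<open>c l\<close>.
\<close>

lemma power_sums_eq_0_imp_eq_0:
  fixes c \<mu> :: "'i \<Rightarrow> 'a :: field"
  assumes fin: "finite I" and inj: "inj_on \<mu> I"
    and zero: "\<And>m. m < card I \<Longrightarrow> (\<Sum>i\<in>I. \<mu> i ^ m * c i) = 0"
    and l: "l \<in> I"
  shows "c l = 0"
proof -
  define p where "p = (\<Prod>i\<in>I - {l}. [:- \<mu> i, 1:])"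
  have "degree p = (\<Sum>i\<in>I - {l}. 1)"
    unfolding p_def by (subst degree_prod_eq_sum_degree) auto
  then have deg: "degree p < card I"
    using card_Diff1_less[OF fin l] by simp
  have "(\<Sum>i\<in>I. poly p (\<mu> i) * c i) = 0"
  proof -
    have "(\<Sum>i\<in>I. poly p (\<mu> i) * c i)
        = (\<Sum>i\<in>I. \<Sum>m\<le>degree p. coeff p m * (\<mu> i ^ m * c i))"
      by (simp add: poly_altdef sum_distrib_right mult.assoc)
    also have "\<dots> = (\<Sum>m\<le>degree p. coeff p m * (\<Sum>i\<in>I. \<mu> i ^ m * c i))"
      by (subst sum.swap) (simp add: sum_distrib_left)
    also have "\<dots> = 0"
      using deg by (intro sum.neutral) (auto simp: zero)
    finally show ?thesis .
  qed
  moreover have "poly p (\<mu> i) = 0" if "i \<in> I" "i \<noteq> l" for i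
    using fin that by (auto simp: p_def poly_prod)
  then have "(\<Sum>i\<in>I. poly p (\<mu> i) * c i) = poly p (\<mu> l) * c l"
    using fin l by (subst sum.remove[OF fin l]) (auto intro: sum.neutral)
  moreover have "poly p (\<mu> l) \<noteq> 0"
    using fin inj l by (auto simp: p_def poly_prod inj_on_def)
  ultimately show ?thesis by simp
qed

text \<open>
  Unlike in \<open>eigenvector_pow\<close>, the vector may be zero, as are the columns that pad the eigenspaces
  of smaller dimension.
\<close>

lemma pow_mat_mult_vec_eigen:
  fixes A :: "'a :: field mat"
  assumes A: "A \<in> carrier_mat n n" and v: "v \<in> carrier_vec n" and Av: "A *\<^sub>v v = x \<cdot>\<^sub>v v"
  shows "A ^\<^sub>m m *\<^sub>v v = x ^ m \<cdot>\<^sub>v v"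
proof (induction m)
  case 0
  then show ?case using A v by simp
next
  case (Suc m)
  have P: "A ^\<^sub>m m \<in> carrier_mat n n" using A by simp
  have "A ^\<^sub>m Suc m *\<^sub>v v = A ^\<^sub>m m *\<^sub>v (A *\<^sub>v v)"
    using assoc_mult_mat_vec[OF P A v] by simp
  also have "\<dots> = x \<cdot>\<^sub>v (A ^\<^sub>m m *\<^sub>v v)"
    unfolding Av using mult_mat_vec[OF P v] by simp
  also have "\<dots> = x ^ Suc m \<cdot>\<^sub>v v"
    by (simp add: Suc.IH smult_smult_assoc)
  finally show ?case .
qed

section \<open>Full rank and controllability by duality\<close>

text \<open>
  If \<open>C C\<^sup>T w = 0\<close> then \<open>C\<^sup>T w\<close> has length zero, so \<open>C C\<^sup>T\<close> inherits the trivial kernel. Being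
  square it is invertible, and each \<open>v = C (C\<^sup>T (C C\<^sup>T)\<^sup>-\<^sup>1 v)\<close> lies in the column space. This uses that
  a sum of squares vanishes only if its terms do, hence the real entries.
\<close>

lemma rank_eq_if_trivial_left_kernel:
  fixes C :: "real mat"
  assumes C: "C \<in> carrier_mat n nc"
    and ker: "\<And>w. w \<in> carrier_vec n \<Longrightarrow> \<forall>c \<in> set (cols C). w \<bullet> c = 0 \<Longrightarrow> w = 0\<^sub>v n"
  shows "vec_space.rank n C = n"
proof -
  interpret vec_space "TYPE(real)" n .
  let ?M = "C * transpose_mat C"
  have CT: "transpose_mat C \<in> carrier_mat nc n" and M: "?M \<in> carrier_mat n n"
    using C by auto
  have colsC: "set (cols C) \<subseteq> carrier_vec n"
    using C cols_dim by blast
  have "det ?M \<noteq> 0"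
  proof
    assume "det ?M = 0"
    then obtain w where w: "w \<in> carrier_vec n" "w \<noteq> 0\<^sub>v n" and Mw: "?M *\<^sub>v w = 0\<^sub>v n"
      using det_0_iff_vec_prod_zero_field[OF M] by auto
    have y: "transpose_mat C *\<^sub>v w \<in> carrier_vec nc"
      using CT w(1) by auto
    have "C *\<^sub>v (transpose_mat C *\<^sub>v w) = 0\<^sub>v n"
      using assoc_mult_mat_vec[OF C CT w(1)] Mw by simp
    then have "(transpose_mat C *\<^sub>v w) \<bullet> (transpose_mat C *\<^sub>v w) = 0"
      using transpose_vec_mult_scalar[OF C y w(1)] w(1) by simp
    then have y0: "transpose_mat C *\<^sub>v w = 0\<^sub>v nc"
      using conjugate_square_eq_0_vec[OF y] by simp
    have "w \<bullet> c = 0" if c: "c \<in> set (cols C)" for c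
    proof -
      obtain j where j: "j < nc" "c = col C j"
        using c C by (auto simp: in_set_conv_nth)
      have "c \<bullet> w = (transpose_mat C *\<^sub>v w) $ j"
        using j C by simp
      then have "c \<bullet> w = 0" using y0 j(1) by simp
      then show ?thesis
        using comm_scalar_prod[of w n c] w(1) c colsC by auto
    qed
    then show False using ker w by blast
  qed
  then obtain N where N: "N \<in> carrier_mat n n" and MN: "?M * N = 1\<^sub>m n"
    using det_non_zero_imp_unit[OF M] by (auto simp: Units_def ring_mat_def)
  have "carrier_vec n \<subseteq> span (set (cols C))"
  proof
    fix v :: "real vec"
    assume v: "v \<in> carrier_vec n"
    define y where "y = transpose_mat C *\<^sub>v (N *\<^sub>v v)"
    have y: "y \<in> carrier_vec nc" unfolding y_def using CT N v by auto
    have Nv: "N *\<^sub>v v \<in> carrier_vec n" using N v by auto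
    have "v = C *\<^sub>v y"
      unfolding y_def
      using assoc_mult_mat_vec[OF C CT Nv] assoc_mult_mat_vec[OF M N v] MN v by simp
    also have "\<dots> = sumlist (map (\<lambda>j. y $ j \<cdot>\<^sub>v col C j) [0..<nc])"
    proof (rule eq_vecI)
      have dims: "\<forall>x \<in> set (map (\<lambda>j. y $ j \<cdot>\<^sub>v col C j) [0..<nc]). dim_vec x = n"
        using C by auto
      show "dim_vec (C *\<^sub>v y) = dim_vec (sumlist (map (\<lambda>j. y $ j \<cdot>\<^sub>v col C j) [0..<nc]))"
        using dim_sumlist[OF dims] C by simp
      fix l assume "l < dim_vec (sumlist (map (\<lambda>j. y $ j \<cdot>\<^sub>v col C j) [0..<nc]))"
      then have l: "l < n" using dim_sumlist[OF dims] by simp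
      then show "(C *\<^sub>v y) $ l = sumlist (map (\<lambda>j. y $ j \<cdot>\<^sub>v col C j) [0..<nc]) $ l"
        using C y by (subst sumlist_nth[OF dims l]) (simp add: scalar_prod_def mult.commute)
    qed
    also have "\<dots> \<in> span (set (cols C))"
    proof (rule sumlist_in_span[OF colsC])
      fix x assume "x \<in> set (map (\<lambda>j. y $ j \<cdot>\<^sub>v col C j) [0..<nc])"
      then obtain j where j: "j < nc" "x = y $ j \<cdot>\<^sub>v col C j" by auto
      have "col C j \<in> set (cols C)" using j(1) C by (simp add: cols_def)
      then show "x \<in> span (set (cols C))"
        unfolding j(2) by (intro smult_in_span[OF colsC] span_mem[OF colsC])
    qed
    finally show "v \<in> span (set (cols C))" .
  qed
  then have "span (set (cols C)) = carrier V"
    using span_closed[OF colsC] by auto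
  moreover have "vs (carrier V) = V"
    by (simp add: module_vec_def)
  ultimately show ?thesis
    unfolding rank_def by (simp only: dim_is_n)
qed

lemma set_cols_hconcat:
  assumes "\<forall>M \<in> set Ms. dim_row M = n"
  shows "set (cols (hconcat n Ms)) = (\<Union>M \<in> set Ms. set (cols M))"
proof -
  have "set (concat (map cols Ms)) \<subseteq> carrier_vec n"
    using assms by (auto simp: cols_def)
  then show ?thesis by (simp add: hconcat_def)
qed

text \<open>
  The dual description of controllability: no nonzero vector is orthogonal to everything reachable.
\<close>

lemma controllable_if_trivial_unreachable:
  fixes A B :: "real mat"
  assumes A: "A \<in> carrier_mat n n" and B: "B \<in> carrier_mat n p"
    and unreach: "\<And>w. w \<in> carrier_vec n \<Longrightarrow>
      \<forall>m<n. \<forall>j<p. w \<bullet> (A ^\<^sub>m m *\<^sub>v col B j) = 0 \<Longrightarrow> w = 0\<^sub>v n"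
  shows "controllable A B"
proof -
  let ?C = "controllability_matrix A B"
  have C: "?C \<in> carrier_mat n (dim_col ?C)"
    using A unfolding controllability_matrix_def hconcat_def by auto
  have cols: "set (cols ?C) = (\<Union>m<n. set (cols (A ^\<^sub>m m * B)))"
    using A by (auto simp: controllability_matrix_def set_cols_hconcat)
  have "w = 0\<^sub>v n" if w: "w \<in> carrier_vec n" and orth: "\<forall>c \<in> set (cols ?C). w \<bullet> c = 0" for w
  proof (rule unreach[OF w], intro allI impI)
    fix m j assume m: "m < n" and j: "j < p"
    have P: "A ^\<^sub>m m \<in> carrier_mat n n" using A by simp
    have "col (A ^\<^sub>m m * B) j \<in> set (cols ?C)"
      unfolding cols using m j B by (intro UN_I[of m]) (auto simp: cols_def)
    then show "w \<bullet> (A ^\<^sub>m m *\<^sub>v col B j) = 0"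
      using orth col_mult2[OF P B j] by auto
  qed
  then have "vec_space.rank n ?C = n"
    by (rule rank_eq_if_trivial_left_kernel[OF C])
  then show ?thesis
    using A B by (auto simp: controllable_def)
qed

section \<open>Inputs that superpose eigenvectors\<close>

text \<open>
  An input built by superposing one eigenvector per eigenvalue excites each of them separately,
  because iterating \<open>A\<close> scales them at different rates. The last hypothesis says that the
  eigenvectors span the space, in the form in which it meets the unreachable directions.
\<close>

lemma controllable_sum_of_eigenvectors:
  fixes A :: "real mat" and \<mu> :: "nat \<Rightarrow> real" and u :: "nat \<Rightarrow> nat \<Rightarrow> real vec"
  assumes A: "A \<in> carrier_mat n n"
    and inj: "inj_on \<mu> {0..<r}" and r: "r \<le> n"
    and u: "\<And>i j. i < r \<Longrightarrow> j < p \<Longrightarrow> u i j \<in> carrier_vec n"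
    and eig: "\<And>i j. i < r \<Longrightarrow> j < p \<Longrightarrow> A *\<^sub>v u i j = \<mu> i \<cdot>\<^sub>v u i j"
    and total: "\<And>w. w \<in> carrier_vec n \<Longrightarrow> \<forall>i<r. \<forall>j<p. w \<bullet> u i j = 0 \<Longrightarrow> w = 0\<^sub>v n"
  shows "controllable A
    (mat_of_cols n (map (\<lambda>j. finsum_vec TYPE(real) n (\<lambda>i. u i j) {0..<r}) [0..<p]))"
proof -
  interpret vec_space "TYPE(real)" n .
  define b where "b j = finsum V (\<lambda>i. u i j) {0..<r}" for j
  define B where "B = mat_of_cols n (map b [0..<p])"
  have B: "B \<in> carrier_mat n p" unfolding B_def using mat_of_cols_carrier(1) by fastforce
  have b: "b j \<in> carrier_vec n" if "j < p" for j
    unfolding b_def using u that finsum_closed[of "\<lambda>i. u i j" "{0..<r}"] by auto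
  have colB: "col B j = b j" if "j < p" for j
    using that b by (simp add: B_def)
  have "controllable A B"
  proof (rule controllable_if_trivial_unreachable[OF A B])
    fix w :: "real vec"
    assume w: "w \<in> carrier_vec n"
      and orth: "\<forall>m<n. \<forall>j<p. w \<bullet> (A ^\<^sub>m m *\<^sub>v col B j) = 0"
    have "w \<bullet> u i j = 0" if i: "i < r" and j: "j < p" for i j
    proof (rule power_sums_eq_0_imp_eq_0[where c = "\<lambda>i. w \<bullet> u i j", OF _ inj])
      fix m assume "m < card {0..<r}"
      then have m: "m < n" using r by simp
      have P: "A ^\<^sub>m m \<in> carrier_mat n n" using A by simp
      \<comment> \<open>Moving the matrix power onto \<open>w\<close> lets the scalar product distribute over the sum.\<close>
      define w' where "w' = transpose_mat (A ^\<^sub>m m) *\<^sub>v w"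
      have w': "w' \<in> carrier_vec n" unfolding w'_def using P w by auto
      have shift: "w \<bullet> (A ^\<^sub>m m *\<^sub>v v) = w' \<bullet> v" if "v \<in> carrier_vec n" for v
        unfolding w'_def using transpose_vec_mult_scalar[OF P that w] by simp
      have "0 = w' \<bullet> b j"
        using orth[rule_format, OF m j] shift[OF b[OF j]] colB[OF j] by simp
      also have "\<dots> = b j \<bullet> w'"
        by (rule comm_scalar_prod[OF w' b[OF j]])
      also have "\<dots> = (\<Sum>i\<in>{0..<r}. u i j \<bullet> w')"
        unfolding b_def using u j by (intro finsum_scalar_prod_sum[OF _ w']) auto
      also have "\<dots> = (\<Sum>i\<in>{0..<r}. \<mu> i ^ m * (w \<bullet> u i j))"
      proof (rule sum.cong[OF refl])
        fix i assume "i \<in> {0..<r}"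
        then have i: "i < r" by simp
        have "u i j \<bullet> w' = w \<bullet> (A ^\<^sub>m m *\<^sub>v u i j)"
          using shift[OF u[OF i j]] comm_scalar_prod[OF u[OF i j] w'] by simp
        also have "\<dots> = \<mu> i ^ m * (w \<bullet> u i j)"
          using pow_mat_mult_vec_eigen[OF A u[OF i j] eig[OF i j]] w u[OF i j] by simp
        finally show "u i j \<bullet> w' = \<mu> i ^ m * (w \<bullet> u i j)" .
      qed
      finally show "(\<Sum>i\<in>{0..<r}. \<mu> i ^ m * (w \<bullet> u i j)) = 0" by simp
    qed (use i in auto)
    then show "w = 0\<^sub>v n" using total[OF w] by blast
  qed
  then show ?thesis unfolding B_def b_def by simp
qed

text \<open>Distinct eigenvalues are distinct roots of the characteristic polynomial.\<close>

lemma card_eigenvalues_le: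
  fixes A :: "'a :: field mat"
  assumes A: "A \<in> carrier_mat n n"
  shows "card {x. eigenvalue A x} \<le> n"
proof -
  have "char_poly A \<noteq> 0" and "degree (char_poly A) = n"
    using degree_monic_char_poly[OF A] by auto
  then show ?thesis
    using card_poly_roots_bound[of "char_poly A"] by (simp add: eigenvalue_root_char_poly[OF A])
qed

theorem theorem5:
  fixes G :: "'a pair_pre_digraph" and vs :: "'a list" and n r k :: nat
    and lam :: "nat \<Rightarrow> real" and q :: "nat \<Rightarrow> nat"
    and Vb Vbar :: "nat \<Rightarrow> real mat" and L V B :: "real mat"
  assumes "cograph G" and "connected (with_proj G)" and "card (pverts G) = n"
    and "distinct vs" and "set vs = pverts G"
    and "L = laplacian vs G"
    and "bij_betw lam {0..<r} {x. eigenvalue L x}"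
    and "\<forall>i<r. q i = Polynomial.order (lam i) (char_poly L)"
    and "\<forall>i<r. Vb i \<in> carrier_mat n (q i)"
    and "V = hconcat n (map Vb [0..<r])"
    and "normalized_modal_matrix L V"
    and "\<forall>i<r. L * Vb i = lam i \<cdot>\<^sub>m Vb i"
    and "k < r" and "q k = Max (q ` {0..<r})"
    and "\<forall>i<r. Vbar i = hconcat n [Vb i, 0\<^sub>m n (q k - q i)]"
    and "B = mat_of_cols n
           (map (\<lambda>j. finsum_vec TYPE(real) n (\<lambda>i. col (Vbar i) j) {0..<r}) [0..<q k])"
  shows "controllable (- L) B"
proof -
  have "length vs = n"
    using distinct_card[OF assms(4)] assms(3,5) by simp
  then have L: "L \<in> carrier_mat n n"
    unfolding assms(6) laplacian_def degree_matrix_def adjacency_matrix_def mat_diag_def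
    by (simp add: minus_carrier_mat)
  then have negL: "- L \<in> carrier_mat n n" by simp
  have Vb: "Vb i \<in> carrier_mat n (q i)" if "i < r" for i
    using assms(9) that by simp
  have V: "V \<in> carrier_mat n n" and VVT: "V * transpose_mat V = 1\<^sub>m n"
    using assms(11) L by (auto simp: normalized_modal_matrix_def modal_matrix_def)
  have inj: "inj_on (\<lambda>i. - lam i) {0..<r}"
    using assms(7) by (auto simp: bij_betw_def inj_on_def)
  have "r = card {x. eigenvalue L x}"
    using bij_betw_same_card[OF assms(7)] by simp
  then have rn: "r \<le> n"
    using card_eigenvalues_le[OF L] by simp
  have qk: "q i \<le> q k" if "i < r" for i
    using assms(14) that by simp
  have Vbar: "Vbar i = mat_of_cols n (cols (Vb i) @ replicate (q k - q i) (0\<^sub>v n))" if "i < r" for i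
  proof -
    have "cols (0\<^sub>m n (q k - q i)) = replicate (q k - q i) (0\<^sub>v n :: real vec)"
      by (rule nth_equalityI) auto
    then show ?thesis using assms(15) that by (simp add: hconcat_def)
  qed
  have colVbar: "col (Vbar i) j = (if j < q i then col (Vb i) j else 0\<^sub>v n)"
    if i: "i < r" and j: "j < q k" for i j
    using Vb[OF i] qk[OF i] j col_dim[of "Vb i" j] unfolding Vbar[OF i]
    by (subst col_mat_of_cols) (auto simp: nth_append)
  have neg_eig: "- L *\<^sub>v v = - x \<cdot>\<^sub>v v" if "v \<in> carrier_vec n" and "L *\<^sub>v v = x \<cdot>\<^sub>v v"
    for v and x :: real
    using that L uminus_mult_mat_vec[of v L] by (intro eq_vecI) auto
  show ?thesis
    unfolding assms(16)
  proof (rule controllable_sum_of_eigenvectors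
      [where u = "\<lambda>i j. col (Vbar i) j", OF negL inj rn])
    fix i j assume i: "i < r" and j: "j < q k"
    show c: "col (Vbar i) j \<in> carrier_vec n"
      using colVbar[OF i j] col_dim[of "Vb i" j] carrier_matD(1)[OF Vb[OF i]] by simp
    have "L *\<^sub>v col (Vbar i) j = lam i \<cdot>\<^sub>v col (Vbar i) j"
    proof (cases "j < q i")
      case True
      have "L *\<^sub>v col (Vb i) j = col (L * Vb i) j"
        using col_mult2[OF L Vb[OF i] True] by simp
      also have "\<dots> = lam i \<cdot>\<^sub>v col (Vb i) j"
        using assms(12) i col_smult[of j "Vb i" "lam i"] Vb[OF i] True by simp
      finally show ?thesis
        using True colVbar[OF i j] by simp
    next
      case False
      then show ?thesis using colVbar[OF i j] L by auto
    qed
    then show "- L *\<^sub>v col (Vbar i) j = - lam i \<cdot>\<^sub>v col (Vbar i) j"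
      by (rule neg_eig[OF c])
  next
    fix w :: "real vec"
    assume w: "w \<in> carrier_vec n" and orth: "\<forall>i<r. \<forall>j<q k. w \<bullet> col (Vbar i) j = 0"
    have colsV: "set (cols V) = (\<Union>i<r. set (cols (Vb i)))"
      unfolding assms(10) using carrier_matD(1)[OF Vb] by (subst set_cols_hconcat) auto
    \<comment> \<open>The entries of \<open>V\<^sup>T w\<close> are the scalar products of \<open>w\<close> with the columns of the blocks, and
      \<open>V V\<^sup>T = 1\<close> recovers \<open>w\<close> from them.\<close>
    have "transpose_mat V *\<^sub>v w = 0\<^sub>v n"
    proof (rule eq_vecI)
      fix l assume "l < dim_vec (0\<^sub>v n :: real vec)"
      then have l: "l < n" by simp
      then have "col V l \<in> set (cols V)" using V by (auto simp: cols_def)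
      then obtain i where i: "i < r" and "col V l \<in> set (cols (Vb i))"
        unfolding colsV by blast
      then obtain j where j: "j < q i" and eq: "col V l = col (Vb i) j"
        using Vb[OF i] by (auto simp: cols_def)
      have "w \<bullet> col (Vbar i) j = 0"
        using orth i j qk[OF i] by auto
      then have "w \<bullet> col V l = 0"
        using colVbar[of i j] i j qk[OF i] eq by simp
      then show "(transpose_mat V *\<^sub>v w) $ l = 0\<^sub>v n $ l"
        using l V w comm_scalar_prod[of w n "col V l"] by auto
    qed (use V in auto)
    moreover have "w = V *\<^sub>v (transpose_mat V *\<^sub>v w)"
      using assoc_mult_mat_vec[OF V _ w, of "transpose_mat V"] V VVT w by simp
    ultimately show "w = 0\<^sub>v n" using V by auto
  qed
qed

end
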